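(* (i) Let $x,y\in\mathbb{B}^n$ be distinct and rotate the pair $x,y$ around the midpoint $(x+y)/2$ (both points staying in $\mathbb{B}^n$). If $(x+y)/2\neq 0$, then the distance $h_{\mathbb{B}^n}(x,y)$ is decreasing under such a rotation that increases the angle $\nu\in[0,\pi/2]$ between the lines $L(x,y)$ and $L(0,(x+y)/2)$. If $(x+y)/2=0$, then $h_{\mathbb{B}^n}(x,y)$ is invariant under this rotation. (ii) For all $x,y\in\mathbb{B}^n$, $$2\log\left(\frac{\sqrt{4-|x+y|^2}+|x-y|}{\sqrt{4-|x+y|^2}-|x-y|}\right)\le h_{\mathbb{B}^n}(x,y),$$ and equality holds here if and only if $|x|=|y|$. (iii) If $x,y\in\mathbb{B}^n$ satisfy $|x-y|<2-|x+y|$, then $$h_{\mathbb{B}^n}(x,y)\le\log\left(\frac{(2+|x-y|)^2-|x+y|^2}{(2-|x-y|)^2-|x+y|^2}\right),$$ and equality holds here if and only if $x,y$ are collinear with the origin.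
   Context: Let $n\ge 2$ and let $\mathbb{B}^n$ be the open Euclidean unit ball in $\mathbb{R}^n$, with boundary sphere $S^{n-1}$. For distinct $x,y\in\mathbb{R}^n$, $L(x,y)$ denotes the Euclidean line through $x$ and $y$. Hilbert metric: for distinct $x,y\in\mathbb{B}^n$, $$h_{\mathbb{B}^n}(x,y)=\log\frac{|u-y|\,|x-v|}{|u-x|\,|y-v|},$$ where $u,v$ are the two points of $L(x,y)\cap S^{n-1}$, ordered so that $|u-x|<|u-y|$; and $h_{\mathbb{B}^n}(x,x)=0$. The logarithm is natural. A rotation of the pair $x,y$ around the midpoint $q=(x+y)/2$ replaces it by a pair $x',y'$ with the same midpoint $(x'+y')/2=q$ and the same Euclidean distance $|x'-y'|=|x-y|$; only positions with $x',y'\in\mathbb{B}^n$ are considered. The angle between two intersecting lines is taken in $[0,\pi/2]$. *)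

theory Defs
  imports "HOL-Analysis.Analysis"
begin

text \<open>The line through two distinct points \<open>a\<close>, \<open>b\<close> is \<open>affine hull {a, b}\<close>.\<close>

abbreviation line_through :: "'a::euclidean_space \<Rightarrow> 'a \<Rightarrow> 'a set" where
  "line_through a b \<equiv> affine hull {a, b}"

text \<open>
  The absolute value of the inner product makes this the angle in \<open>[0, pi/2]\<close>, and makes it
  independent of the chosen pairs of points (lemma \<open>line_angle_eq\<close> below).
\<close>

definition line_angle :: "'a::euclidean_space set \<Rightarrow> 'a set \<Rightarrow> real" where
  "line_angle L M = (THE \<nu>. \<exists>a\<in>L. \<exists>b\<in>L. \<exists>c\<in>M. \<exists>d\<in>M. a \<noteq> b \<and> c \<noteq> d \<and>
      \<nu> = arccos (\<bar>(b - a) \<bullet> (d - c)\<bar> / (norm (b - a) * norm (d - c))))"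

text \<open>
  The pair \<open>(u, v)\<close> of points where the line through \<open>x\<close> and \<open>y\<close> meets the unit sphere,
  with \<open>u\<close> on the side of \<open>x\<close>. It is well defined for distinct \<open>x\<close>, \<open>y\<close> in the unit ball
  (lemma \<open>chord_ends_ex1\<close> below).
\<close>

definition chord_ends :: "'a::euclidean_space \<Rightarrow> 'a \<Rightarrow> 'a \<times> 'a" where
  "chord_ends x y = (THE (u, v). u \<noteq> v \<and> line_through x y \<inter> sphere 0 1 = {u, v} \<and>
      dist u x < dist u y)"

text \<open>Meaningful only for points of the open unit ball.\<close>

definition hilbert_dist :: "'a::euclidean_space \<Rightarrow> 'a \<Rightarrow> real" where
  "hilbert_dist x y = (if x = y then 0
     else let (u, v) = chord_ends x y in ln ((dist u y * dist x v) / (dist u x * dist y v)))"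

text \<open>
  A rotation of a pair around its midpoint, as a relation between the old and the new pair:
  it preserves the midpoint and the Euclidean distance, and the new pair lies in the ball.
\<close>

definition midpoint_rotation :: "'a::euclidean_space \<Rightarrow> 'a \<Rightarrow> 'a \<Rightarrow> 'a \<Rightarrow> bool" where
  "midpoint_rotation x y x' y' \<longleftrightarrow> x' \<in> ball 0 1 \<and> y' \<in> ball 0 1 \<and>
     midpoint x' y' = midpoint x y \<and> dist x' y' = dist x y"

lemma mem_line_through_iff: "p \<in> line_through a b \<longleftrightarrow> (\<exists>t. p = a + t *\<^sub>R (b - a))"
proof -
  have "a + t *\<^sub>R (b - a) = (1 - t) *\<^sub>R a + t *\<^sub>R b" for t
    by (simp add: algebra_simps)
  moreover have "u + v = 1 \<longleftrightarrow> u = 1 - v" for u v :: real by auto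
  ultimately show ?thesis by (auto simp: affine_hull_2)
qed

lemma line_angle_eq:
  assumes "x \<noteq> y" "z \<noteq> w"
  shows "line_angle (line_through x y) (line_through z w) =
    arccos (\<bar>(y - x) \<bullet> (w - z)\<bar> / (norm (y - x) * norm (w - z)))"
  unfolding line_angle_def
proof (rule the_equality)
  show "\<exists>a\<in>line_through x y. \<exists>b\<in>line_through x y. \<exists>c\<in>line_through z w. \<exists>d\<in>line_through z w.
      a \<noteq> b \<and> c \<noteq> d \<and> arccos (\<bar>(y - x) \<bullet> (w - z)\<bar> / (norm (y - x) * norm (w - z))) =
      arccos (\<bar>(b - a) \<bullet> (d - c)\<bar> / (norm (b - a) * norm (d - c)))"
    using assms
    by (intro bexI[of _ x] bexI[of _ y] bexI[of _ z] bexI[of _ w] conjI refl hull_inc) simp_all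
next
  fix \<nu>
  assume "\<exists>a\<in>line_through x y. \<exists>b\<in>line_through x y. \<exists>c\<in>line_through z w. \<exists>d\<in>line_through z w.
      a \<noteq> b \<and> c \<noteq> d \<and> \<nu> = arccos (\<bar>(b - a) \<bullet> (d - c)\<bar> / (norm (b - a) * norm (d - c)))"
  then obtain a b c d where mem: "a \<in> line_through x y" "b \<in> line_through x y"
      "c \<in> line_through z w" "d \<in> line_through z w" and ne: "a \<noteq> b" "c \<noteq> d"
    and \<nu>: "\<nu> = arccos (\<bar>(b - a) \<bullet> (d - c)\<bar> / (norm (b - a) * norm (d - c)))"
    by (elim bexE conjE) (rule that)
  obtain s t where ab: "a = x + s *\<^sub>R (y - x)" "b = x + t *\<^sub>R (y - x)"
    using mem(1,2) by (auto simp only: mem_line_through_iff)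
  obtain s' t' where cd: "c = z + s' *\<^sub>R (w - z)" "d = z + t' *\<^sub>R (w - z)"
    using mem(3,4) by (auto simp only: mem_line_through_iff)
  have "b - a = (t - s) *\<^sub>R (y - x)" "d - c = (t' - s') *\<^sub>R (w - z)"
    unfolding ab cd by (simp_all add: algebra_simps)
  moreover have "t - s \<noteq> 0" "t' - s' \<noteq> 0" using ab cd ne by auto
  ultimately show "\<nu> = arccos (\<bar>(y - x) \<bullet> (w - z)\<bar> / (norm (y - x) * norm (w - z)))"
    using \<nu> by (simp add: abs_mult)
qed

lemma chord_ends_ex1:
  assumes "x \<in> ball 0 1" "y \<in> ball 0 1" "x \<noteq> y"
  shows "\<exists>!(u, v). u \<noteq> v \<and> line_through x y \<inter> sphere 0 1 = {u, v} \<and> dist u x < dist u y"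
proof -
  define w A B C where "w = y - x" and "A = w \<bullet> w" and "B = x \<bullet> w" and "C = 1 - x \<bullet> x"
  define P where "P t = x + t *\<^sub>R w" for t
  define D where "D = sqrt (B\<^sup>2 + A * C)"
  define s t where "s = (- B - D) / A" and "t = (- B + D) / A"
  have A: "A > 0" using assms by (simp add: A_def w_def)
  have C: "C > 0"
    using assms by (simp add: C_def dot_square_norm power_less_one_iff)
  have yy: "y \<bullet> y < 1"
    using assms by (simp add: dot_square_norm power_less_one_iff)
  have "y \<bullet> y = A + 2 * B - C + 1"
    by (simp add: A_def B_def C_def w_def inner_diff inner_commute)
  then have AB: "A + 2 * B < C" using yy by simp
  have D2: "D\<^sup>2 = B\<^sup>2 + A * C" using A C by (simp add: D_def)
  have D0: "D \<ge> 0" using A C by (simp add: D_def)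
  have "\<bar>B\<bar> < D" using D2 D0 A C by (intro power2_less_imp_less[of "\<bar>B\<bar>" D]) simp_all
  then have s0: "s < 0" and t0: "t > 0" using A by (auto simp: s_def t_def divide_simps)
  have "(A + B)\<^sup>2 < D\<^sup>2"
    using mult_strict_left_mono[OF AB A] D2 by (simp add: power2_eq_square algebra_simps)
  then have "A + B < D" using D0 by (rule power2_less_imp_less)
  then have t1: "t > 1" using A by (auto simp: t_def divide_simps)
  have sph: "P r \<in> sphere 0 1 \<longleftrightarrow> r = s \<or> r = t" for r
  proof -
    have "P r \<in> sphere 0 1 \<longleftrightarrow> P r \<bullet> P r = 1"
      by (simp add: norm_eq_1)
    also have "P r \<bullet> P r = A * r\<^sup>2 + 2 * B * r - C + 1"
      by (simp add: P_def A_def B_def C_def inner_add inner_commute power2_eq_square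
          algebra_simps)
    also have "A * r\<^sup>2 + 2 * B * r - C + 1 = 1 \<longleftrightarrow> A * (A * r\<^sup>2 + 2 * B * r - C) = 0"
      using A by auto
    also have "A * (A * r\<^sup>2 + 2 * B * r - C) = (A * r + B)\<^sup>2 - D\<^sup>2"
      unfolding D2 by (simp add: power2_eq_square algebra_simps)
    also have "\<dots> = 0 \<longleftrightarrow> A * r + B = D \<or> A * r + B = - D"
      by (simp add: power2_eq_iff)
    also have "\<dots> \<longleftrightarrow> r = s \<or> r = t"
      using A by (auto simp: s_def t_def field_simps)
    finally show ?thesis .
  qed
  have line: "line_through x y = range P"
    by (simp add: set_eq_iff mem_line_through_iff P_def w_def image_iff)
  have int: "line_through x y \<inter> sphere 0 1 = {P s, P t}"
    unfolding line using sph by auto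
  have w0: "w \<noteq> 0" using assms by (simp add: w_def)
  have ne: "P s \<noteq> P t" using s0 t0 w0 by (simp add: P_def)
  have dx: "dist (P r) x = \<bar>r\<bar> * norm w" for r
    by (simp add: P_def dist_norm)
  have "P r - y = (r - 1) *\<^sub>R w" for r
    by (simp add: P_def w_def algebra_simps)
  then have dy: "dist (P r) y = \<bar>r - 1\<bar> * norm w" for r
    by (simp add: dist_norm)
  have cmp: "dist (P r) x < dist (P r) y \<longleftrightarrow> \<bar>r\<bar> < \<bar>r - 1\<bar>" for r
    unfolding dx dy using w0 by (intro mult_less_cancel_right_pos) simp
  have lt: "dist (P s) x < dist (P s) y" "\<not> dist (P t) x < dist (P t) y"
    unfolding cmp using s0 t1 by simp_all
  show ?thesis
  proof (rule ex1I[of _ "(P s, P t)"])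
    show "case (P s, P t) of (u, v) \<Rightarrow>
        u \<noteq> v \<and> line_through x y \<inter> sphere 0 1 = {u, v} \<and> dist u x < dist u y"
      using ne lt int by simp
  next
    fix p assume p: "case p of (u, v) \<Rightarrow>
        u \<noteq> v \<and> line_through x y \<inter> sphere 0 1 = {u, v} \<and> dist u x < dist u y"
    obtain u v where uv: "p = (u, v)" by (cases p)
    have "{P s, P t} = {u, v}" "dist u x < dist u y" using p uv int by simp_all
    then have "u = P s \<and> v = P t" using lt by (metis doubleton_eq_iff)
    then show "p = (P s, P t)" using uv by simp
  qed
qed

end

theory Submission
  imports Defs
begin

text \<open>
  The chord through \<open>x\<close> and \<open>y\<close> is found by solving a quadratic equation, and the cross ratio of
  \<open>x\<close>, \<open>y\<close> and the chord ends is a symmetric expression in its roots. This gives the closed form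
  \<open>hilbert_dist x y = ln ((P + G) / (P - G))\<close> with \<open>P = 1 - x \<bullet> y\<close> and
  \<open>G\<^sup>2 = P\<^sup>2 - (1 - |x|\<^sup>2) (1 - |y|\<^sup>2)\<close>; here \<open>G\<close> is \<open>|x - y|\<close> times half the length of the chord
  (lemma \<open>hilbert_dist_closed_form\<close>).

  The number \<open>P\<close> is determined by \<open>|x + y|\<close> and \<open>|x - y|\<close>, so a rotation about the midpoint leaves it
  unchanged, and the distance is a strictly increasing function of \<open>G\<close> alone. Everything then
  follows from two expressions for \<open>G\<^sup>2\<close>:

    \<open>G\<^sup>2 = |x - y|\<^sup>2 (1 - |x + y|\<^sup>2 / 4) + (|y|\<^sup>2 - |x|\<^sup>2)\<^sup>2 / 4\<close>,

    \<open>G\<^sup>2 = |x - y|\<^sup>2 - (|x|\<^sup>2 |y|\<^sup>2 - (x \<bullet> y)\<^sup>2)\<close>.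

  In the first one, only \<open>|y|\<^sup>2 - |x|\<^sup>2 = 2 (y - x) \<bullet> ((x + y) / 2)\<close> changes during a rotation, and its
  absolute value is proportional to the cosine of the angle between the two lines; this is the
  monotonicity. The value of \<open>G\<close> is smallest exactly when \<open>|x| = |y|\<close>, which is the lower bound. In
  the second one, the Cauchy-Schwarz inequality shows \<open>G \<le> |x - y|\<close>, with equality exactly when
  \<open>x\<close> and \<open>y\<close> are collinear with the origin, which is the upper bound.
\<close>

section \<open>A closed form of the Hilbert distance\<close>

text \<open>
  The quantity \<open>G\<close>. The radicand is the discriminant of the quadratic equation for the chord ends,
  written symmetrically in \<open>x\<close> and \<open>y\<close>; the value is \<open>|x - y|\<close> times half the chord length, which
  is the content of the computation in the lemma \<open>hilbert_dist_closed_form\<close>.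
\<close>

definition weighted_half_chord :: "'a::euclidean_space \<Rightarrow> 'a \<Rightarrow> real" where
  "weighted_half_chord x y = sqrt ((1 - x \<bullet> y)\<^sup>2 - (1 - x \<bullet> x) * (1 - y \<bullet> y))"

lemma inner_self_less_1_iff_ball: "x \<bullet> x < 1 \<longleftrightarrow> x \<in> ball 0 (1::real)"
  by (simp add: dot_square_norm power_less_one_iff)

text \<open>
  Suited to a fixed midpoint and a fixed distance: a rotation changes the last square only.
\<close>

lemma radicand_midpoint_form:
  fixes x y :: "'a::euclidean_space"
  shows "(1 - x \<bullet> y)\<^sup>2 - (1 - x \<bullet> x) * (1 - y \<bullet> y) =
    (norm (x - y))\<^sup>2 * (4 - (norm (x + y))\<^sup>2) / 4 + ((y \<bullet> y - x \<bullet> x) / 2)\<^sup>2"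
  unfolding power2_norm_eq_inner
  by (simp add: inner_diff inner_add inner_commute[of y x] power2_eq_square field_simps)

text \<open>
  The subtracted term is the Gram determinant of \<open>x\<close> and \<open>y\<close>, which vanishes exactly for points
  that are collinear with the origin.
\<close>

lemma radicand_Gram_form:
  fixes x y :: "'a::euclidean_space"
  shows "(1 - x \<bullet> y)\<^sup>2 - (1 - x \<bullet> x) * (1 - y \<bullet> y) =
    (norm (x - y))\<^sup>2 - ((norm x * norm y)\<^sup>2 - (x \<bullet> y)\<^sup>2)"
  unfolding power_mult_distrib power2_norm_eq_inner
  by (simp add: inner_diff inner_commute[of y x] power2_eq_square field_simps)

text \<open>
  This makes \<open>P\<close> an invariant of rotations around the midpoint.
\<close>

lemma one_minus_inner_conv_norms:
  fixes x y :: "'a::euclidean_space"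
  shows "1 - x \<bullet> y = (4 - (norm (x + y))\<^sup>2 + (norm (x - y))\<^sup>2) / 4"
  unfolding power2_norm_eq_inner
  by (simp add: inner_diff inner_add inner_commute[of y x] field_simps)

lemma power2_norm_add_less_4_ball:
  fixes x y :: "'a::euclidean_space"
  assumes "x \<in> ball 0 1" "y \<in> ball 0 1"
  shows "(norm (x + y))\<^sup>2 < 4"
proof -
  have "norm (x + y) < 2" using assms norm_triangle_ineq[of x y] by simp
  then have "(norm (x + y))\<^sup>2 < 2\<^sup>2" by (intro power_strict_mono) simp_all
  then show ?thesis by simp
qed

lemma weighted_half_chord_nonneg:
  assumes "x \<in> ball 0 1" "y \<in> ball 0 1"
  shows "0 \<le> weighted_half_chord x y"
  unfolding weighted_half_chord_def radicand_midpoint_form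
  using power2_norm_add_less_4_ball[OF assms] by simp

text \<open>
  Both \<open>1 - |x|\<^sup>2\<close> and \<open>1 - |y|\<^sup>2\<close> are positive in the ball, so \<open>G\<^sup>2 < P\<^sup>2\<close>; this keeps the argument of
  the logarithm in the closed form positive.
\<close>

lemma weighted_half_chord_less:
  assumes "x \<in> ball 0 1" "y \<in> ball 0 1"
  shows "weighted_half_chord x y < 1 - x \<bullet> y"
proof -
  have "0 < (1 - x \<bullet> x) * (1 - y \<bullet> y)"
    using assms by (simp only: inner_self_less_1_iff_ball[symmetric]) simp
  moreover have "0 < 1 - x \<bullet> y"
    unfolding one_minus_inner_conv_norms using power2_norm_add_less_4_ball[OF assms]
    by (intro divide_pos_pos add_pos_nonneg) simp_all
  ultimately show ?thesis
    unfolding weighted_half_chord_def by (intro real_less_lsqrt) simp_all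
qed

text \<open>
  Points of the line are \<open>x + r (y - x)\<close>, and the chord ends are the roots \<open>s\<close>, \<open>t\<close> of a quadratic
  polynomial \<open>A r\<^sup>2 + 2 B r - C\<close> that is negative at \<open>r = 0\<close> and \<open>r = 1\<close>, because \<open>x\<close> and \<open>y\<close> are
  inside the sphere. Vieta's formulas place \<open>s\<close> before \<open>0\<close> and \<open>t\<close> after \<open>1\<close>, and turn the cross
  ratio \<open>(1 - s) t / ((- s) (t - 1))\<close> into an expression in the coefficients and the discriminant.
\<close>

lemma hilbert_dist_closed_form:
  fixes x y :: "'a::euclidean_space"
  assumes xb: "x \<in> ball 0 1" and yb: "y \<in> ball 0 1"
  shows "hilbert_dist x y =
    ln ((1 - x \<bullet> y + weighted_half_chord x y) / (1 - x \<bullet> y - weighted_half_chord x y))"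
proof (cases "x = y")
  case True
  have "x \<bullet> x < 1" using xb by (simp only: inner_self_less_1_iff_ball)
  then show ?thesis
    using True by (simp add: hilbert_dist_def weighted_half_chord_def power2_eq_square)
next
  case False
  obtain u v where uv: "chord_ends x y = (u, v)" by (cases "chord_ends x y")
  have "case chord_ends x y of (u, v) \<Rightarrow>
      u \<noteq> v \<and> line_through x y \<inter> sphere 0 1 = {u, v} \<and> dist u x < dist u y"
    unfolding chord_ends_def by (rule theI'[OF chord_ends_ex1[OF xb yb False]])
  then have ne: "u \<noteq> v" and int: "line_through x y \<inter> sphere 0 1 = {u, v}"
    and near: "dist u x < dist u y"
    using uv by simp_all
  define w where "w = y - x"
  have w: "norm w > 0" using False by (simp add: w_def)
  from int have "u \<in> line_through x y" "v \<in> line_through x y"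
    and sph: "u \<bullet> u = 1" "v \<bullet> v = 1"
    by (auto simp: norm_eq_1[symmetric])
  then obtain s t where s: "u = x + s *\<^sub>R w" and t: "v = x + t *\<^sub>R w"
    unfolding mem_line_through_iff w_def by blast
  define A B C where "A = w \<bullet> w" and "B = x \<bullet> w" and "C = 1 - x \<bullet> x"
  have A: "A > 0" using w by (simp add: A_def)
  have C: "C > 0" using xb by (simp add: C_def inner_self_less_1_iff_ball)
  have "y \<bullet> y < 1" using yb by (simp only: inner_self_less_1_iff_ball)
  then have ABC: "A + 2 * B - C < 0"
    by (simp add: A_def B_def C_def w_def inner_diff inner_commute)
  have quad: "A * r\<^sup>2 + 2 * B * r - C = 0" if "(x + r *\<^sub>R w) \<bullet> (x + r *\<^sub>R w) = 1" for r
    using that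
    by (simp add: A_def B_def C_def inner_add inner_commute power2_eq_square algebra_simps)
  have qs: "A * s\<^sup>2 + 2 * B * s - C = 0" using quad sph(1) s by simp
  have qt: "A * t\<^sup>2 + 2 * B * t - C = 0" using quad sph(2) t by simp
  have st: "s \<noteq> t" using ne s t by auto
  have "(s - t) * (A * (s + t) + 2 * B) = 0"
    using qs qt by (simp add: power2_eq_square algebra_simps)
  then have sum: "A * (s + t) = - 2 * B" using st by simp
  have "A * (s * t) = s * (A * (s + t)) - A * s\<^sup>2"
    by (simp add: power2_eq_square algebra_simps)
  also have "\<dots> = - C" unfolding sum using qs by (simp add: algebra_simps)
  finally have prod: "A * (s * t) = - C" .
  have dx: "dist (x + r *\<^sub>R w) x = \<bar>r\<bar> * norm w" for r
    by (simp add: dist_norm)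
  have "x + r *\<^sub>R w - y = (r - 1) *\<^sub>R w" for r
    by (simp add: w_def algebra_simps)
  then have dy: "dist (x + r *\<^sub>R w) y = \<bar>r - 1\<bar> * norm w" for r
    by (simp add: dist_norm)
  \<comment> \<open>Only the condition that \<open>u\<close> is nearer to \<open>x\<close> than to \<open>y\<close> distinguishes the two roots.\<close>
  have "\<bar>s\<bar> < \<bar>s - 1\<bar>"
    using near w unfolding s dx dy by simp
  then have s_half: "s < 1 / 2" by linarith
  have "A * (s * t) < 0" using prod C by simp
  then have st0: "s * t < 0" using A by (simp add: mult_less_0_iff)
  have "A * ((1 - s) * (1 - t)) = A - A * (s + t) + A * (s * t)" by (simp add: algebra_simps)
  also have "\<dots> < 0" unfolding sum prod using ABC by simp
  finally have "(1 - s) * (1 - t) < 0" using A by (simp add: mult_less_0_iff)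
  then have t1: "t > 1" using s_half by (simp add: mult_less_0_iff)
  then have s0: "s < 0" using st0 by (simp add: mult_less_0_iff)
  \<comment> \<open>\<open>A = |x - y|\<^sup>2\<close>, and the chord has length \<open>(t - s) |x - y|\<close>.\<close>
  define G where "G = A * (t - s) / 2"
  have "G\<^sup>2 = ((A * (s + t))\<^sup>2 - 4 * A * (A * (s * t))) / 4"
    by (simp add: G_def power2_eq_square field_simps)
  also have "\<dots> = B\<^sup>2 + A * C" unfolding sum prod by (simp add: power2_eq_square)
  also have "\<dots> = (1 - x \<bullet> y)\<^sup>2 - (1 - x \<bullet> x) * (1 - y \<bullet> y)"
    by (simp add: A_def B_def C_def w_def inner_diff inner_commute[of y x] power2_eq_square
        algebra_simps)
  finally have "G = weighted_half_chord x y"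
    unfolding weighted_half_chord_def using A s0 t1
    by (intro real_sqrt_unique[symmetric]) (simp_all add: G_def)
  have P: "1 - x \<bullet> y = C - B"
    by (simp add: C_def B_def w_def inner_diff)
  have num: "1 - x \<bullet> y + G = A * ((1 - s) * t)"
  proof -
    have "A * ((1 - s) * t) = A * (s + t) / 2 + G - A * (s * t)"
      by (simp add: G_def field_simps)
    then show ?thesis unfolding sum prod P by simp
  qed
  have den: "1 - x \<bullet> y - G = A * ((- s) * (t - 1))"
  proof -
    have "A * ((- s) * (t - 1)) = A * (s + t) / 2 - G - A * (s * t)"
      by (simp add: G_def field_simps)
    then show ?thesis unfolding sum prod P by simp
  qed
  have "dist u x = (- s) * norm w" "dist u y = (1 - s) * norm w"
    unfolding s dx dy using s0 by simp_all
  moreover have "dist x v = t * norm w" "dist y v = (t - 1) * norm w"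
    unfolding dist_commute[of _ v] unfolding t dx dy using t1 by simp_all
  ultimately have "dist u y * dist x v / (dist u x * dist y v) =
      ((1 - s) * norm w) * (t * norm w) / (((- s) * norm w) * ((t - 1) * norm w))"
    by simp
  also have "\<dots> = (1 - s) * t / ((- s) * (t - 1))"
    using w by simp
  also have "\<dots> = (1 - x \<bullet> y + G) / (1 - x \<bullet> y - G)"
    unfolding num den using A by simp
  finally show ?thesis
    using False uv \<open>G = weighted_half_chord x y\<close> by (simp add: hilbert_dist_def)
qed

section \<open>Comparing distances\<close>

text \<open>
  This reduces every comparison of distances with a common \<open>P\<close> to a comparison of the values of \<open>G\<close>.
\<close>

lemma ln_symmetric_ratio_less_iff:
  fixes p a b :: real
  assumes "0 \<le> a" "a < p" "0 \<le> b" "b < p"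
  shows "ln ((p + a) / (p - a)) < ln ((p + b) / (p - b)) \<longleftrightarrow> a < b"
proof -
  have "ln ((p + a) / (p - a)) < ln ((p + b) / (p - b)) \<longleftrightarrow>
      (p + a) / (p - a) < (p + b) / (p - b)"
    using assms by (intro ln_less_cancel_iff) simp_all
  also have "\<dots> \<longleftrightarrow> (p + a) * (p - b) < (p + b) * (p - a)"
    using assms by (simp add: divide_simps)
  also have "\<dots> \<longleftrightarrow> p * a < p * b" by (simp add: algebra_simps)
  also have "\<dots> \<longleftrightarrow> a < b" using assms by simp
  finally show ?thesis .
qed

lemma ln_symmetric_ratio_le_iff:
  fixes p a b :: real
  assumes "0 \<le> a" "a < p" "0 \<le> b" "b < p"
  shows "ln ((p + a) / (p - a)) \<le> ln ((p + b) / (p - b)) \<longleftrightarrow> a \<le> b"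
  unfolding not_less[symmetric] using ln_symmetric_ratio_less_iff[of b p a] assms by simp

lemma ln_symmetric_ratio_eq_iff:
  fixes p a b :: real
  assumes "0 \<le> a" "a < p" "0 \<le> b" "b < p"
  shows "ln ((p + a) / (p - a)) = ln ((p + b) / (p - b)) \<longleftrightarrow> a = b"
  using ln_symmetric_ratio_le_iff[of a p b] ln_symmetric_ratio_le_iff[of b p a] assms
  by (metis order_antisym order_refl)

section \<open>Rotation around the midpoint\<close>

lemma midpoint_rotation_norms:
  assumes "midpoint_rotation x y x' y'"
  shows "norm (x' + y') = norm (x + y)" "norm (x' - y') = norm (x - y)"
  using assms by (auto simp: midpoint_rotation_def midpoint_def dist_norm)

lemma inner_diff_midpoint: "(y - x) \<bullet> midpoint x y = (y \<bullet> y - x \<bullet> x) / 2"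
  by (simp add: midpoint_def inner_diff inner_add inner_commute[of y x])

lemma hilbert_dist_rotation_cong:
  assumes "x \<in> ball 0 1" "y \<in> ball 0 1" "midpoint_rotation x y x' y'"
    and "(y' \<bullet> y' - x' \<bullet> x')\<^sup>2 = (y \<bullet> y - x \<bullet> x)\<^sup>2"
  shows "hilbert_dist x' y' = hilbert_dist x y"
proof -
  have b': "x' \<in> ball 0 1" "y' \<in> ball 0 1"
    using assms(3) by (simp_all add: midpoint_rotation_def)
  have "1 - x' \<bullet> y' = 1 - x \<bullet> y"
    unfolding one_minus_inner_conv_norms midpoint_rotation_norms[OF assms(3)] ..
  moreover have "weighted_half_chord x' y' = weighted_half_chord x y"
    unfolding weighted_half_chord_def radicand_midpoint_form
      midpoint_rotation_norms[OF assms(3)]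
    using assms(4) by (simp add: power_divide)
  ultimately show ?thesis
    unfolding hilbert_dist_closed_form[OF assms(1,2)] hilbert_dist_closed_form[OF b'] by simp
qed

lemma hilbert_dist_rotation_less:
  assumes "x \<in> ball 0 1" "y \<in> ball 0 1" "midpoint_rotation x y x' y'"
    and "\<bar>y' \<bullet> y' - x' \<bullet> x'\<bar> < \<bar>y \<bullet> y - x \<bullet> x\<bar>"
  shows "hilbert_dist x' y' < hilbert_dist x y"
proof -
  have b': "x' \<in> ball 0 1" "y' \<in> ball 0 1"
    using assms(3) by (simp_all add: midpoint_rotation_def)
  have P: "1 - x' \<bullet> y' = 1 - x \<bullet> y"
    unfolding one_minus_inner_conv_norms midpoint_rotation_norms[OF assms(3)] ..
  have "(y' \<bullet> y' - x' \<bullet> x')\<^sup>2 < (y \<bullet> y - x \<bullet> x)\<^sup>2"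
    using assms(4) unfolding not_le[symmetric] abs_le_square_iff .
  then have G: "weighted_half_chord x' y' < weighted_half_chord x y"
    unfolding weighted_half_chord_def radicand_midpoint_form
      midpoint_rotation_norms[OF assms(3)]
    by (simp add: power_divide)
  show ?thesis
    unfolding hilbert_dist_closed_form[OF assms(1,2)] hilbert_dist_closed_form[OF b'] P
    using weighted_half_chord_nonneg[OF assms(1,2)] weighted_half_chord_nonneg[OF b']
      weighted_half_chord_less[OF assms(1,2)] weighted_half_chord_less[OF b'] G P
    by (subst ln_symmetric_ratio_less_iff) simp_all
qed

text \<open>
  Both cosines have the same denominator, because a rotation keeps \<open>|x - y|\<close> and the midpoint. A
  larger angle therefore means a smaller \<open>|(y - x) \<bullet> midpoint x y|\<close>, which is half of
  \<open>\<bar>|y|\<^sup>2 - |x|\<^sup>2\<bar>\<close>.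
\<close>

lemma hilbert_dist_rotation_angle:
  assumes xb: "x \<in> ball 0 1" and yb: "y \<in> ball 0 1" and ne: "x \<noteq> y"
    and rot: "midpoint_rotation x y x' y'" and m0: "midpoint x y \<noteq> 0"
    and angle: "line_angle (line_through x y) (line_through 0 (midpoint x y))
      < line_angle (line_through x' y') (line_through 0 (midpoint x y))"
  shows "hilbert_dist x' y' < hilbert_dist x y"
proof -
  define m where "m = midpoint x y"
  have m': "midpoint x' y' = m" and d': "norm (y' - x') = norm (y - x)"
    using rot by (auto simp: midpoint_rotation_def m_def dist_norm norm_minus_commute)
  have ne': "x' \<noteq> y'" using d' ne by auto
  have pos: "0 < norm (y - x) * norm m" using ne m0 by (simp add: m_def)
  have cos: "\<bar>\<bar>v \<bullet> m\<bar> / (norm v * norm m)\<bar> \<le> 1" for v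
    using Cauchy_Schwarz_ineq2[of v m] by (cases "v = 0 \<or> m = 0") auto
  have "arccos (\<bar>(y - x) \<bullet> m\<bar> / (norm (y - x) * norm m))
      < arccos (\<bar>(y' - x') \<bullet> m\<bar> / (norm (y' - x') * norm m))"
    using angle m0 by (simp add: line_angle_eq[OF ne] line_angle_eq[OF ne'] m_def)
  then have "\<bar>(y' - x') \<bullet> m\<bar> / (norm (y - x) * norm m) < \<bar>(y - x) \<bullet> m\<bar> / (norm (y - x) * norm m)"
    using cos[of "y - x"] cos[of "y' - x'"] by (simp only: arccos_less_mono d')
  then have "\<bar>(y' - x') \<bullet> m\<bar> < \<bar>(y - x) \<bullet> m\<bar>"
    using pos by (simp add: divide_less_cancel)
  then have "\<bar>y' \<bullet> y' - x' \<bullet> x'\<bar> < \<bar>y \<bullet> y - x \<bullet> x\<bar>"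
    using inner_diff_midpoint[of y x] inner_diff_midpoint[of y' x'] by (simp add: m'[unfolded m_def] m_def)
  then show ?thesis by (rule hilbert_dist_rotation_less[OF xb yb rot])
qed

lemma hilbert_dist_rotation_centred:
  assumes "x \<in> ball 0 1" "y \<in> ball 0 1" "midpoint_rotation x y x' y'" "midpoint x y = 0"
  shows "hilbert_dist x' y' = hilbert_dist x y"
proof (rule hilbert_dist_rotation_cong[OF assms(1-3)])
  have "midpoint x' y' = 0" using assms(3,4) by (simp add: midpoint_rotation_def)
  then show "(y' \<bullet> y' - x' \<bullet> x')\<^sup>2 = (y \<bullet> y - x \<bullet> x)\<^sup>2"
    using inner_diff_midpoint[of y x] inner_diff_midpoint[of y' x'] assms(4) by simp
qed

section \<open>Sharp bounds\<close>

text \<open>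
  The bound is the value of the closed form at \<open>G = |x - y| sqrt (4 - |x + y|\<^sup>2) / 2\<close>, which is
  what remains of \<open>G\<close> when \<open>|y|\<^sup>2 - |x|\<^sup>2\<close> is replaced by \<open>0\<close>. For this value of \<open>G\<close>, the
  numbers \<open>4 (P + G)\<close> and \<open>4 (P - G)\<close> are the squares of \<open>T + d\<close> and \<open>T - d\<close>; hence the factor \<open>2\<close> before the logarithm.
\<close>

lemma hilbert_dist_lower_bound:
  fixes x y :: "'a::euclidean_space"
  assumes xb: "x \<in> ball 0 1" and yb: "y \<in> ball 0 1"
  defines "T \<equiv> sqrt (4 - (norm (x + y))\<^sup>2)" and "d \<equiv> norm (x - y)"
  shows "2 * ln ((T + d) / (T - d)) \<le> hilbert_dist x y"
    and "2 * ln ((T + d) / (T - d)) = hilbert_dist x y \<longleftrightarrow> norm x = norm y"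
proof -
  define P G where "P = 1 - x \<bullet> y" and "G = weighted_half_chord x y"
  have T2: "T\<^sup>2 = 4 - (norm (x + y))\<^sup>2"
    using power2_norm_add_less_4_ball[OF xb yb] by (simp add: T_def)
  have T0: "T > 0" using power2_norm_add_less_4_ball[OF xb yb] by (simp add: T_def)
  have d0: "d \<ge> 0" by (simp add: d_def)
  have G2: "G = sqrt ((T * d / 2)\<^sup>2 + ((y \<bullet> y - x \<bullet> x) / 2)\<^sup>2)"
    unfolding G_def weighted_half_chord_def radicand_midpoint_form
    by (simp add: power_divide power_mult_distrib T2 d_def)
  have P: "4 * P = T\<^sup>2 + d\<^sup>2"
    unfolding P_def one_minus_inner_conv_norms T2 d_def by simp
  have G: "0 \<le> G" "G < P"
    unfolding G_def P_def
    by (rule weighted_half_chord_nonneg[OF xb yb], rule weighted_half_chord_less[OF xb yb])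
  have le: "T * d / 2 \<le> G"
    unfolding G2 by (rule real_le_rsqrt) simp
  have eq: "T * d / 2 = G \<longleftrightarrow> norm x = norm y"
  proof -
    have "T * d / 2 = G \<longleftrightarrow> sqrt ((T * d / 2)\<^sup>2) = G" using T0 d0 by simp
    also have "\<dots> \<longleftrightarrow> y \<bullet> y = x \<bullet> x" unfolding G2 real_sqrt_eq_iff by simp
    also have "\<dots> \<longleftrightarrow> norm x = norm y" by (auto simp: norm_eq)
    finally show ?thesis .
  qed
  have sq: "(T + d)\<^sup>2 = 4 * (P + T * d / 2)" "(T - d)\<^sup>2 = 4 * (P - T * d / 2)"
    unfolding distrib_left right_diff_distrib P
    by (simp_all add: power2_eq_square field_simps)
  have "d < T"
  proof -
    have "T\<^sup>2 - d\<^sup>2 = 2 * (1 - x \<bullet> x) + 2 * (1 - y \<bullet> y)"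
      unfolding T2 d_def power2_norm_eq_inner
      by (simp add: inner_diff inner_add inner_commute[of y x] field_simps)
    moreover have "x \<bullet> x < 1" "y \<bullet> y < 1"
      using xb yb by (simp_all only: inner_self_less_1_iff_ball)
    ultimately have "d\<^sup>2 < T\<^sup>2" by simp
    then show ?thesis using T0 by (rule power2_less_imp_less[OF _ less_imp_le])
  qed
  then have "2 * ln ((T + d) / (T - d)) = ln (((T + d) / (T - d))\<^sup>2)"
    using d0 ln_realpow[of "(T + d) / (T - d)" 2] by simp
  also have "((T + d) / (T - d))\<^sup>2 = (P + T * d / 2) / (P - T * d / 2)"
    unfolding power_divide sq mult_divide_mult_cancel_left_if by simp
  finally have lhs: "2 * ln ((T + d) / (T - d)) = ln ((P + T * d / 2) / (P - T * d / 2))" .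
  have rhs: "hilbert_dist x y = ln ((P + G) / (P - G))"
    unfolding P_def G_def by (rule hilbert_dist_closed_form[OF xb yb])
  have Td: "0 \<le> T * d / 2" "T * d / 2 < P" using T0 d0 le G by simp_all
  show "2 * ln ((T + d) / (T - d)) \<le> hilbert_dist x y"
    unfolding lhs rhs using ln_symmetric_ratio_le_iff[OF Td G] le by simp
  show "2 * ln ((T + d) / (T - d)) = hilbert_dist x y \<longleftrightarrow> norm x = norm y"
    unfolding lhs rhs using ln_symmetric_ratio_eq_iff[OF Td G] eq by simp
qed

text \<open>
  The bound is the value of the closed form at \<open>G = |x - y|\<close>. The hypothesis says that the pair
  stays in the ball when it is rotated onto the line through the origin, and it makes
  \<open>4 (P - |x - y|) = (2 - |x - y|)\<^sup>2 - |x + y|\<^sup>2\<close> positive.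
\<close>

lemma hilbert_dist_upper_bound:
  fixes x y :: "'a::euclidean_space"
  assumes xb: "x \<in> ball 0 1" and yb: "y \<in> ball 0 1"
    and small: "norm (x - y) < 2 - norm (x + y)"
  defines "d \<equiv> norm (x - y)" and "m \<equiv> norm (x + y)"
  shows "hilbert_dist x y \<le> ln (((2 + d)\<^sup>2 - m\<^sup>2) / ((2 - d)\<^sup>2 - m\<^sup>2))"
    and "hilbert_dist x y = ln (((2 + d)\<^sup>2 - m\<^sup>2) / ((2 - d)\<^sup>2 - m\<^sup>2)) \<longleftrightarrow> collinear {0, x, y}"
proof -
  define P G where "P = 1 - x \<bullet> y" and "G = weighted_half_chord x y"
  have d0: "d \<ge> 0" by (simp add: d_def)
  have G2: "G = sqrt (d\<^sup>2 - ((norm x * norm y)\<^sup>2 - (x \<bullet> y)\<^sup>2))"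
    unfolding G_def weighted_half_chord_def radicand_Gram_form d_def ..
  have G: "0 \<le> G" "G < P"
    unfolding G_def P_def
    by (rule weighted_half_chord_nonneg[OF xb yb], rule weighted_half_chord_less[OF xb yb])
  have "\<bar>x \<bullet> y\<bar> \<le> \<bar>norm x * norm y\<bar>" using Cauchy_Schwarz_ineq2[of x y] by simp
  then have "(x \<bullet> y)\<^sup>2 \<le> (norm x * norm y)\<^sup>2" by (simp only: abs_le_square_iff)
  then have le: "G \<le> d"
    unfolding G2 using d0 by (intro real_le_lsqrt) simp_all
  have eq: "G = d \<longleftrightarrow> collinear {0, x, y}"
  proof -
    have "G = d \<longleftrightarrow> G = sqrt (d\<^sup>2)" using d0 by simp
    also have "\<dots> \<longleftrightarrow> (x \<bullet> y)\<^sup>2 = (norm x * norm y)\<^sup>2" unfolding G2 real_sqrt_eq_iff by auto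
    also have "\<dots> \<longleftrightarrow> \<bar>x \<bullet> y\<bar> = norm x * norm y"
      using power2_eq_iff_nonneg[of "\<bar>x \<bullet> y\<bar>" "norm x * norm y"] by simp
    also have "\<dots> \<longleftrightarrow> collinear {0, x, y}" by (rule norm_cauchy_schwarz_equal)
    finally show ?thesis .
  qed
  have P: "4 * P = 4 - m\<^sup>2 + d\<^sup>2"
    unfolding P_def one_minus_inner_conv_norms d_def m_def by simp
  have sq: "(2 + d)\<^sup>2 - m\<^sup>2 = 4 * (P + d)" "(2 - d)\<^sup>2 - m\<^sup>2 = 4 * (P - d)"
    unfolding distrib_left right_diff_distrib P
    by (simp_all add: power2_eq_square algebra_simps)
  have "m\<^sup>2 < (2 - d)\<^sup>2"
    using small by (intro power_strict_mono) (simp_all add: d_def m_def)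
  then have d: "d < P" using sq(2) by simp
  have rhs: "ln (((2 + d)\<^sup>2 - m\<^sup>2) / ((2 - d)\<^sup>2 - m\<^sup>2)) = ln ((P + d) / (P - d))"
    unfolding sq mult_divide_mult_cancel_left_if by simp
  have lhs: "hilbert_dist x y = ln ((P + G) / (P - G))"
    unfolding P_def G_def by (rule hilbert_dist_closed_form[OF xb yb])
  show "hilbert_dist x y \<le> ln (((2 + d)\<^sup>2 - m\<^sup>2) / ((2 - d)\<^sup>2 - m\<^sup>2))"
    unfolding lhs rhs using ln_symmetric_ratio_le_iff[OF G d0 d] le by simp
  show "hilbert_dist x y = ln (((2 + d)\<^sup>2 - m\<^sup>2) / ((2 - d)\<^sup>2 - m\<^sup>2)) \<longleftrightarrow> collinear {0, x, y}"
    unfolding lhs rhs using ln_symmetric_ratio_eq_iff[OF G d0 d] eq by simp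
qed

theorem theorem4p7:
  assumes dim: "CARD('n::finite) \<ge> 2"
  shows
    "(\<forall>x y x' y' :: real ^ 'n.
        x \<in> ball 0 1 \<and> y \<in> ball 0 1 \<and> x \<noteq> y \<and> midpoint_rotation x y x' y' \<longrightarrow>
          (midpoint x y \<noteq> 0 \<longrightarrow>
             line_angle (line_through x y) (line_through 0 (midpoint x y))
               < line_angle (line_through x' y') (line_through 0 (midpoint x y)) \<longrightarrow>
             hilbert_dist x' y' < hilbert_dist x y) \<and>
          (midpoint x y = 0 \<longrightarrow> hilbert_dist x' y' = hilbert_dist x y))
     \<and>
     (\<forall>x y :: real ^ 'n. x \<in> ball 0 1 \<and> y \<in> ball 0 1 \<longrightarrow>
        2 * ln ((sqrt (4 - (norm (x + y))\<^sup>2) + norm (x - y)) /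
                (sqrt (4 - (norm (x + y))\<^sup>2) - norm (x - y))) \<le> hilbert_dist x y \<and>
        (2 * ln ((sqrt (4 - (norm (x + y))\<^sup>2) + norm (x - y)) /
                 (sqrt (4 - (norm (x + y))\<^sup>2) - norm (x - y))) = hilbert_dist x y
           \<longleftrightarrow> norm x = norm y))
     \<and>
     (\<forall>x y :: real ^ 'n. x \<in> ball 0 1 \<and> y \<in> ball 0 1 \<and> norm (x - y) < 2 - norm (x + y) \<longrightarrow>
        hilbert_dist x y \<le> ln (((2 + norm (x - y))\<^sup>2 - (norm (x + y))\<^sup>2) /
                                ((2 - norm (x - y))\<^sup>2 - (norm (x + y))\<^sup>2)) \<and>
        (hilbert_dist x y = ln (((2 + norm (x - y))\<^sup>2 - (norm (x + y))\<^sup>2) /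
                                ((2 - norm (x - y))\<^sup>2 - (norm (x + y))\<^sup>2))
           \<longleftrightarrow> collinear {0, x, y}))"
  by (intro conjI allI impI; elim conjE)
    ((rule hilbert_dist_rotation_angle hilbert_dist_rotation_centred
      hilbert_dist_lower_bound hilbert_dist_upper_bound; assumption)+)


end
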